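(* Let $n,k\ge 2$ be integers and let $K_n^k$ denote the one point union of $k$ copies of the complete graph $K_n$. Then $$hc(K_n^k)=\begin{cases}(n-1)^2, & \text{if } k=2,\\ k(k-2)(n-1)^2+n-1, & \text{if } k\ge 3.\end{cases}$$
   Context: $K_n^k$ is the graph obtained from $k$ copies of $K_n$ by identifying one vertex $v$ of each copy into a single common vertex, so that any two copies are edge-disjoint and share only $v$. For a graph $G$ of order $p$, $D(u,v)$ is the length of a longest $u$–$v$ path; a hamiltonian coloring is a map $c:V(G)\to\{0,1,2,\dots\}$ with $D(u,v)+|c(u)-c(v)|\ge p-1$ for all distinct $u,v$; $hc(c)=\max_v c(v)$, and $hc(G)$ is the minimum of $hc(c)$ over all hamiltonian colorings $c$ of $G$ (colors start at $0$). *)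

theory Defs
  imports "Graph_Theory.Graph_Theory"
begin

text \<open>
  Following the library, an undirected simple graph is a symmetric digraph that is finite, loopfree
  and without parallel arcs (locale \<open>graph\<close>): every edge is a pair of opposite arcs.
  Hence a \<open>u\<close>-\<open>v\<close> path of the undirected graph is an \<open>apath\<close> from \<open>u\<close> to \<open>v\<close>, and its length is the
  number of its arcs.
\<close>

text \<open>
  The one point union is determined only up to isomorphism, so it is a predicate: \<open>G\<close> is the union
  of the copies \<open>H 0, \<dots>, H (k - 1)\<close> of the complete graph, any two of which share exactly the
  vertex \<open>v\<close>.  Edge-disjointness of the copies follows, since there are no loops at \<open>v\<close>.
\<close>

definition one_point_union_complete :: "nat \<Rightarrow> nat \<Rightarrow> ('a, 'b) pre_digraph \<Rightarrow> bool" where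
  "one_point_union_complete n k G \<longleftrightarrow>
    (\<exists>v (H :: nat \<Rightarrow> ('a, 'b) pre_digraph).
       (\<forall>i<k. subgraph (H i) G \<and> complete_digraph n (H i) \<and> v \<in> verts (H i)) \<and>
       (\<forall>i<k. \<forall>j<k. i \<noteq> j \<longrightarrow> verts (H i) \<inter> verts (H j) = {v}) \<and>
       verts G = (\<Union>i<k. verts (H i)) \<and>
       arcs G = (\<Union>i<k. arcs (H i)))"

text \<open>Meaningful for \<open>u\<close> and \<open>v\<close> in the same component of a finite graph.\<close>

definition detour_distance :: "('a, 'b) pre_digraph \<Rightarrow> 'a \<Rightarrow> 'a \<Rightarrow> nat" where
  "detour_distance G u v = Max {length p | p. pre_digraph.apath G u p v}"

definition hamiltonian_coloring :: "('a, 'b) pre_digraph \<Rightarrow> ('a \<Rightarrow> nat) \<Rightarrow> bool" where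
  "hamiltonian_coloring G c \<longleftrightarrow>
    (\<forall>u\<in>verts G. \<forall>v\<in>verts G. u \<noteq> v \<longrightarrow>
       int (detour_distance G u v) + \<bar>int (c u) - int (c v)\<bar> \<ge> int (card (verts G)) - 1)"

definition coloring_span :: "('a, 'b) pre_digraph \<Rightarrow> ('a \<Rightarrow> nat) \<Rightarrow> nat" where
  "coloring_span G c = Max (c ` verts G)"

definition hc :: "('a, 'b) pre_digraph \<Rightarrow> nat" where
  "hc G = (LEAST m. \<exists>c. hamiltonian_coloring G c \<and> coloring_span G c = m)"

lemma one_point_union_complete_imp_graph:
  assumes "one_point_union_complete n k G" and "k \<ge> 1"
  shows "graph G"
proof -
  from assms(1) obtain v H where
    *: "\<forall>i<k. subgraph (H i) G \<and> complete_digraph n (H i) \<and> v \<in> verts (H i)"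
       "\<forall>i<k. \<forall>j<k. i \<noteq> j \<longrightarrow> verts (H i) \<inter> verts (H j) = {v}" and
    V: "verts G = (\<Union>i<k. verts (H i))" and A: "arcs G = (\<Union>i<k. arcs (H i))"
    unfolding one_point_union_complete_def by (elim exE conjE)
  have H: "subgraph (H i) G" "graph (H i)" if "i < k" for i
    using *(1) that by (simp_all add: complete_digraph_def)
  have inter: "verts (H i) \<inter> verts (H j) = {v}" if "i < k" "j < k" "i \<noteq> j" for i j
    using *(2) that by simp
  have comp: "tail (H i) = tail G" "head (H i) = head G" if "i < k" for i
    using H(1)[OF that] by (auto simp: subgraph_def compatible_def)
  have wf: "wf_digraph G" using H(1)[of 0] assms(2) by (auto simp: subgraph_def)
  have ends: "tail G e \<in> verts (H i)" "head G e \<in> verts (H i)" "tail G e \<noteq> head G e"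
    if "i < k" "e \<in> arcs (H i)" for i e
  proof -
    interpret graph "H i" using that by (intro H(2))
    show "tail G e \<in> verts (H i)" "head G e \<in> verts (H i)" "tail G e \<noteq> head G e"
      using tail_in_verts[OF that(2)] head_in_verts[OF that(2)] no_loops[OF that(2)]
      by (simp_all add: comp[OF that(1)])
  qed
  have fin: "finite (verts (H i))" "finite (arcs (H i))" if "i < k" for i
  proof -
    interpret graph "H i" using that by (intro H(2))
    show "finite (verts (H i))" "finite (arcs (H i))" by auto
  qed
  have nm: "e = f" if ef: "e \<in> arcs G" "f \<in> arcs G" "arc_to_ends G e = arc_to_ends G f" for e f
  proof -
    obtain i j where ij: "i < k" "e \<in> arcs (H i)" "j < k" "f \<in> arcs (H j)"
      using ef(1,2) unfolding A by blast
    have eq: "tail G e = tail G f" "head G e = head G f"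
      using ef(3) by (auto simp: arc_to_ends_def)
    have "i = j"
    proof (rule ccontr)
      assume "i \<noteq> j"
      then have "verts (H i) \<inter> verts (H j) = {v}" using inter ij by blast
      then have "tail G e = v" "head G e = v"
        using ends(1,2)[OF ij(1,2)] ends(1,2)[OF ij(3,4)] unfolding eq by blast+
      then show False using ends(3)[OF ij(1,2)] by simp
    qed
    interpret graph "H i" using ij(1) by (rule H(2))
    have "arc_to_ends (H i) e = arc_to_ends (H i) f"
      using eq by (simp add: arc_to_ends_def comp[OF ij(1)])
    with ij \<open>i = j\<close> show ?thesis by (intro no_multi_arcs) simp_all
  qed
  have sym: "symmetric G"
  proof -
    have "(b, a) \<in> arcs_ends G" if "(a, b) \<in> arcs_ends G" for a b
    proof -
      obtain e i where e: "i < k" "e \<in> arcs (H i)" "a = tail G e" "b = head G e"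
        using \<open>(a, b) \<in> arcs_ends G\<close> A by (auto simp: arcs_ends_def arc_to_ends_def)
      interpret graph "H i" using e(1) by (rule H(2))
      have "(a, b) \<in> arcs_ends (H i)"
        using e comp[of i] by (auto simp: arcs_ends_def arc_to_ends_def)
      then have "(b, a) \<in> arcs_ends (H i)" using sym_arcs by (auto simp: symmetric_def dest: symD)
      then show ?thesis using e A comp[of i] by (auto simp: arcs_ends_def arc_to_ends_def)
    qed
    then show ?thesis unfolding symmetric_def by (blast intro: symI)
  qed
  interpret wf_digraph G by (rule wf)
  show ?thesis
  proof unfold_locales
    show "finite (verts G)" "finite (arcs G)" using V A fin by auto
    show "tail G e \<noteq> head G e" if "e \<in> arcs G" for e using that ends(3) unfolding A by blast
    show "symmetric G" by (rule sym)
    show "e = f" if "e \<in> arcs G" "f \<in> arcs G" "arc_to_ends G e = arc_to_ends G f" for e f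
      using that by (rule nm)
  qed
qed

lemma one_point_union_complete_exists:
  assumes "n \<ge> 1" and "k \<ge> 1"
  shows "\<exists>G :: (nat \<times> nat, (nat \<times> nat) \<times> (nat \<times> nat)) pre_digraph. one_point_union_complete n k G"
proof -
  define B where "B i = insert (0, 0) ({i} \<times> {1..<n})" for i :: nat
  define C where "C i = \<lparr>pverts = B i, parcs = {(x, y). x \<in> B i \<and> y \<in> B i \<and> x \<noteq> y}\<rparr>" for i
  define P where "P = \<lparr>pverts = (\<Union>i<k. B i), parcs = (\<Union>i<k. parcs (C i))\<rparr>"
  have complete: "complete_digraph n (with_proj (C i))" for i
    unfolding complete_digraph_pair_def using assms(1)
    by (auto simp: C_def B_def card_insert_if card_cartesian_product)
  have sub: "subgraph (with_proj (C i)) (with_proj P)" if "i < k" for i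
    using that by (auto simp: subgraph_def compatible_def wf_digraph_def P_def C_def)
  have inter: "B i \<inter> B j = {(0, 0)}" if "i \<noteq> j" for i j
    using that by (auto simp: B_def)
  have "one_point_union_complete n k (with_proj P)"
    unfolding one_point_union_complete_def
  proof (intro exI conjI allI impI)
    fix i assume "i < k"
    then show "subgraph (with_proj (C i)) (with_proj P)" by (rule sub)
    show "complete_digraph n (with_proj (C i))" by (rule complete)
    show "(0, 0) \<in> verts (with_proj (C i))" by (simp add: C_def B_def)
  next
    fix i j assume "i < k" "j < k" "i \<noteq> j"
    then show "verts (with_proj (C i)) \<inter> verts (with_proj (C j)) = {(0, 0)}"
      using inter by (simp add: C_def)
  next
    show "verts (with_proj P) = (\<Union>i<k. verts (with_proj (C i)))" by (simp add: P_def C_def)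
    show "arcs (with_proj P) = (\<Union>i<k. arcs (with_proj (C i)))" by (simp add: P_def)
  qed
  then show ?thesis by blast
qed

end

theory Submission
  imports Defs
begin

text \<open>
  Write \<open>m = n - 1\<close>.  Two vertices of the same copy have detour distance \<open>m\<close>, two vertices of
  different copies (both different from \<open>v\<close>) have detour distance \<open>2 m\<close>.  As \<open>G\<close> has \<open>k m + 1\<close>
  vertices, the colors must differ by at least \<open>(k - 1) m\<close> in the first case and by at least
  \<open>(k - 2) m\<close> in the second.  For \<open>k = 2\<close> the colors of one copy already span \<open>m\<^sup>2\<close>.  For \<open>k \<ge> 3\<close>,
  sort the \<open>k m + 1\<close> vertices by color: each of the \<open>k m\<close> gaps is at least \<open>(k - 2) m\<close>, and a gap
  next to \<open>v\<close> is larger by \<open>m\<close>.  Giving \<open>v\<close> the color \<open>0\<close> and then going through the copies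
  cyclically attains this bound, since for \<open>k \<ge> 3\<close> two vertices of the same copy are at least
  two gaps apart and \<open>2 (k - 2) \<ge> k - 1\<close>.
\<close>

section \<open>Spaced values, the span, and paths in cliques\<close>

text \<open>In order of increasing \<open>f\<close>, each element exceeds its predecessor by at
  least \<open>d\<close>, so the gaps add up above \<open>b\<close>.\<close>

lemma separated_ge:
  fixes f :: "'a \<Rightarrow> nat"
  assumes "finite S" "S \<noteq> {}"
    and "\<And>x. x \<in> S \<Longrightarrow> b \<le> f x"
    and "\<And>x y. x \<in> S \<Longrightarrow> y \<in> S \<Longrightarrow> x \<noteq> y \<Longrightarrow> int d \<le> \<bar>int (f x) - int (f y)\<bar>"
  obtains x where "x \<in> S" "b + (card S - 1) * d \<le> f x"
proof -
  have "\<exists>x\<in>S. b + (card S - 1) * d \<le> f x"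
    using assms
  proof (induction S rule: finite_ranking_induct[where f = f])
    case empty
    then show ?case by simp
  next
    case (insert x S)
    \<comment> \<open>The ranking induction makes \<open>f x\<close> maximal but does not make
      \<open>x\<close> new to \<open>S\<close>.\<close>
    show ?case
    proof (cases "S = {} \<or> x \<in> S")
      case True
      then show ?thesis
      proof
        assume "x \<in> S"
        then have eq: "insert x S = S" by auto
        show ?thesis using insert.IH insert.prems unfolding eq by blast
      qed (use insert.prems in auto)
    next
      case False
      then obtain y where y: "y \<in> S" "b + (card S - 1) * d \<le> f y"
        using insert.IH insert.prems by auto
      have "f y \<le> f x" "x \<noteq> y" using y insert.hyps False by auto
      with insert.prems(3)[of x y] y have "f y + d \<le> f x" by auto
      moreover have "(card S - 1) * d + d = card S * d"
        using False insert.hyps(1) by (cases "card S") auto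
      ultimately show ?thesis using y False insert.hyps(1) by auto
    qed
  qed
  then show ?thesis using that by blast
qed

text \<open>The exhibited coloring only has to stay within \<open>b\<close>: the lower bound applies
  to it too and makes its span exactly \<open>b\<close>.\<close>

lemma hc_eqI:
  assumes "finite (verts G)" "verts G \<noteq> {}"
    and upper: "hamiltonian_coloring G c" "\<And>x. x \<in> verts G \<Longrightarrow> c x \<le> b"
    and lower: "\<And>c. hamiltonian_coloring G c \<Longrightarrow> \<exists>x\<in>verts G. b \<le> c x"
  shows "hc G = b"
  unfolding hc_def
proof (rule Least_equality)
  have ge: "b \<le> coloring_span G c" if "hamiltonian_coloring G c" for c
    using lower[OF that] assms(1,2) by (auto simp: coloring_span_def Max_ge_iff)
  have "coloring_span G c \<le> b"
    using upper(2) assms(1,2) by (auto simp: coloring_span_def)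
  then show "\<exists>c. hamiltonian_coloring G c \<and> coloring_span G c = b"
    using ge upper(1) by (blast intro: antisym)
  show "b \<le> s" if "\<exists>c. hamiltonian_coloring G c \<and> coloring_span G c = s" for s
    using that ge by auto
qed

text \<open>Induction on the inner vertices with the start generalized: step from \<open>u\<close>
  to the new vertex and continue from there to the fixed end \<open>w\<close>.\<close>

lemma (in wf_digraph) hamiltonian_apath_in_clique:
  assumes "finite X" "u \<noteq> w" "u \<notin> X" "w \<notin> X"
    and "\<And>x y. x \<in> insert u (insert w X) \<Longrightarrow> y \<in> insert u (insert w X) \<Longrightarrow> x \<noteq> y \<Longrightarrow> x \<rightarrow>\<^bsub>G\<^esub> y"
  shows "\<exists>p. apath u p w \<and> set (awalk_verts u p) = insert u (insert w X)"
  using assms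
proof (induction X arbitrary: u rule: finite_induct)
  case empty
  then obtain e where "e \<in> arcs G" "tail G e = u" "head G e = w" by fastforce
  then show ?case using empty by (intro exI[of _ "[e]"]) (auto simp: apath_simps)
next
  case (insert x X)
  have "\<exists>p. apath x p w \<and> set (awalk_verts x p) = insert x (insert w X)"
    using insert.hyps insert.prems by (intro insert.IH) auto
  then obtain p where p: "apath x p w" "set (awalk_verts x p) = insert x (insert w X)" by blast
  have "u \<rightarrow>\<^bsub>G\<^esub> x" using insert.prems by auto
  then obtain e where "e \<in> arcs G" "tail G e = u" "head G e = x" by blast
  then show ?case
    using p insert.prems by (intro exI[of _ "e # p"]) (auto simp: apath_simps)
qed

section \<open>The one point union: copies and vertex counts\<close>

text \<open>The copies survive only as vertex sets \<open>B i\<close> containing \<open>v\<close>;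
  their arcs enter solely through adjacency in \<open>dominates_iff\<close>, so paths are studied
  without subgraphs.\<close>

locale one_point_union = graph G
  for G :: "('a, 'b) pre_digraph" +
  fixes v :: 'a and B :: "nat \<Rightarrow> 'a set" and m k :: nat
  assumes finite_B: "i < k \<Longrightarrow> finite (B i)"
    and card_B: "i < k \<Longrightarrow> card (B i) = Suc m"
    and v_in_B: "i < k \<Longrightarrow> v \<in> B i"
    and B_Int: "i < k \<Longrightarrow> j < k \<Longrightarrow> i \<noteq> j \<Longrightarrow> B i \<inter> B j = {v}"
    and verts_eq: "verts G = (\<Union>i<k. B i)"
    and dominates_iff: "x \<rightarrow>\<^bsub>G\<^esub> y \<longleftrightarrow> (\<exists>i<k. x \<in> B i \<and> y \<in> B i \<and> x \<noteq> y)"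
    and k_ge_2: "2 \<le> k"
    and m_pos: "0 < m"
begin

lemma B_eqI: "i = j" if "i < k" "j < k" "x \<in> B i" "x \<in> B j" "x \<noteq> v"
  using B_Int[OF that(1,2)] that by blast

lemma v_in_verts: "v \<in> verts G"
  using v_in_B[of 0] k_ge_2 verts_eq by auto

lemma card_B_minus: "i < k \<Longrightarrow> card (B i - {v}) = m"
  using card_B v_in_B by simp

lemma card_verts_minus: "card (verts G - {v}) = k * m"
proof -
  have "verts G - {v} = (\<Union>i\<in>{..<k}. B i - {v})" by (auto simp: verts_eq)
  also have "card \<dots> = (\<Sum>i<k. card (B i - {v}))"
    by (rule card_UN_disjoint) (auto simp: finite_B dest: B_eqI)
  also have "\<dots> = k * m" by (simp add: card_B_minus)
  finally show ?thesis .
qed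

lemma card_verts: "card (verts G) = Suc (k * m)"
  using card_verts_minus v_in_verts by (metis card.remove finite_verts)

lemma card_B_Un:
  assumes "i < k" "j < k"
  shows "card (B i \<union> B j) = (if i = j then Suc m else Suc (2 * m))"
proof (cases "i = j")
  case False
  then show ?thesis
    using card_Un_Int[OF finite_B[OF assms(1)] finite_B[OF assms(2)]]
    by (simp add: B_Int[OF assms] card_B[OF assms(1)] card_B[OF assms(2)])
qed (simp add: card_B[OF assms(2)])

section \<open>Detour distances\<close>

text \<open>Distinct copies share only \<open>v\<close>, so an arc from any other vertex of
  \<open>B i\<close> stays in \<open>B i\<close>; the walk can leave only from
  \<open>v\<close>.\<close>

lemma awalk_leaving_copy:
  assumes "awalk x p y" "i < k" "x \<in> B i" "y \<notin> B i"
  shows "v \<in> set (awalk_verts x p)"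
  using assms(1,3)
proof (induction p arbitrary: x)
  case Nil
  then show ?case using assms(4) by (simp add: awalk_Nil_iff)
next
  case (Cons e p)
  then have e: "e \<in> arcs G" "x = tail G e" "awalk (head G e) p y"
    by (auto simp: awalk_Cons_iff)
  then obtain j where j: "j < k" "x \<in> B j" "head G e \<in> B j"
    using dominates_iff[of x "head G e"] in_arcs_imp_in_arcs_ends by blast
  show ?case
  proof (cases "i = j")
    case True
    then show ?thesis using Cons.IH[OF e(3)] j by simp
  next
    case False
    then have "x = v" using j assms(2) Cons.prems B_eqI by blast
    then show ?thesis using e by simp
  qed
qed

lemma awalk_between_copies:
  assumes "awalk x p y" "i < k" "x \<in> B i" "j < k" "y \<in> B j" "i \<noteq> j"
  shows "v \<in> set (awalk_verts x p)"
proof (cases "y = v")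
  \<comment> \<open>Here the walk need not leave \<open>B i\<close>, since \<open>v\<close> lies in
    every copy; but it ends in \<open>v\<close>.\<close>
  case True
  then have "last (awalk_verts x p) = v"
    using awlast_if_cas[of x p y] assms(1) unfolding awalk_def by blast
  then show ?thesis using last_in_set awalk_verts_non_Nil by metis
next
  case False
  then have "y \<notin> B i" using B_eqI[of i j y] assms by blast
  then show ?thesis by (rule awalk_leaving_copy[OF assms(1-3)])
qed

text \<open>A detour into a third copy would have to pass through \<open>v\<close> twice.\<close>

lemma apath_verts_subset:
  assumes p: "apath u p w" and "i < k" "j < k" "u \<in> B i" "w \<in> B j"
  shows "set (awalk_verts u p) \<subseteq> B i \<union> B j"
proof
  fix x assume x: "x \<in> set (awalk_verts u p)"
  show "x \<in> B i \<union> B j"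
  proof (rule ccontr)
    assume nin: "x \<notin> B i \<union> B j"
    have "x \<in> verts G" using x p by (auto simp: apath_def)
    then obtain l where l: "l < k" "x \<in> B l" by (auto simp: verts_eq)
    have xv: "x \<noteq> v" using nin v_in_B assms(2) by auto
    have "awalk u p w" using p by (simp add: apath_def)
    from awalk_decomp[OF this x] obtain q r
      where qr: "p = q @ r" "awalk u q x" "awalk x r w" by blast
    have "v \<in> set (awalk_verts u q)"
      using awalk_between_copies qr(2) assms l nin by blast
    moreover have "v \<in> set (awalk_verts x r)"
      using awalk_between_copies qr(3) assms l nin by blast
    \<comment> \<open>Both pieces contain \<open>x\<close>, so they are disjoint only once the first
      vertex of \<open>r\<close> is dropped; as \<open>x\<close> is not \<open>v\<close>, the visit
      to \<open>v\<close> in \<open>r\<close> remains.\<close>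
    then have "v \<in> set (tl (awalk_verts x r))"
      using xv qr(3) by (cases r) (auto simp: awalk_Cons_iff)
    ultimately show False
      using apath_decomp_disjoint[OF p qr(1)] qr(2) by auto
  qed
qed

lemma apath_covering_copy:
  assumes "i < k" "x \<in> B i" "y \<in> B i" "x \<noteq> y"
  shows "\<exists>p. apath x p y \<and> set (awalk_verts x p) = B i"
proof -
  have eq: "insert x (insert y (B i - {x, y})) = B i" using assms by auto
  show ?thesis
    using hamiltonian_apath_in_clique[of "B i - {x, y}" x y] assms finite_B dominates_iff
    unfolding eq by auto
qed

text \<open>A longest path visits all of \<open>B i \<union> B j\<close>: by
  \<open>apath_verts_subset\<close> it can visit no more, and for distinct copies two covering paths
  are joined at \<open>v\<close>. The last assumption is there because \<open>v\<close> lies in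
  every copy: its distance to any other vertex is \<open>m\<close>, obtained from the case
  \<open>i = j\<close>.\<close>

lemma detour_distance_eq:
  assumes ij: "i < k" "j < k" and uw: "u \<in> B i" "w \<in> B j" "u \<noteq> w"
    and v: "i \<noteq> j \<Longrightarrow> u \<noteq> v \<and> w \<noteq> v"
  shows "detour_distance G u w = (if i = j then m else 2 * m)"
proof -
  have len: "Suc (length p) = card (set (awalk_verts u p))" if "apath u p w" for p
    using that by (metis apath_def distinct_card length_awalk_verts)
  have "\<exists>p. apath u p w \<and> set (awalk_verts u p) = B i \<union> B j"
  proof (cases "i = j")
    case True
    then show ?thesis using apath_covering_copy ij uw by simp
  next
    case False
    obtain p where p: "apath u p v" "set (awalk_verts u p) = B i"
      using apath_covering_copy[of i u v] ij uw v False v_in_B by blast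
    obtain q where q: "apath v q w" "set (awalk_verts v q) = B j"
      using apath_covering_copy[of j v w] ij uw v False v_in_B by blast
    have aw: "awalk u p v" "awalk v q w" using p q by (auto simp: apath_def)
    \<comment> \<open>\<open>p\<close> ends where \<open>q\<close> starts, so only the vertices of
      \<open>q\<close> after \<open>v\<close> must avoid \<open>B i\<close>.\<close>
    have "v \<notin> set (tl (awalk_verts v q))"
      using q(1) aw(2) by (cases q) (auto simp: apath_simps)
    moreover have "set (tl (awalk_verts v q)) \<subseteq> B j"
      using q(2) by (metis list.set_sel(2) subsetI awalk_verts_non_Nil)
    ultimately have "set (awalk_verts u p) \<inter> set (tl (awalk_verts v q)) = {}"
      using B_Int[OF ij False] unfolding p(2) by auto
    then have "apath u (p @ q) w" using p q aw by (simp add: apath_append_iff)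
    moreover have "set (awalk_verts u (p @ q)) = B i \<union> B j"
      using set_awalk_verts_append[OF aw] p q by simp
    ultimately show ?thesis by blast
  qed
  then obtain p where p: "apath u p w" "set (awalk_verts u p) = B i \<union> B j" by blast
  have "length q \<le> length p" if "apath u q w" for q
    using len[OF that] len[OF p(1)] p(2) apath_verts_subset[OF that ij uw(1,2)]
      card_mono[of "B i \<union> B j" "set (awalk_verts u q)"] finite_B ij by simp
  moreover have "finite {length q | q. apath u q w}"
    using apaths_finite[of u w] by (simp add: setcompr_eq_image)
  ultimately have "detour_distance G u w = length p"
    unfolding detour_distance_def using p(1) by (intro Max_eqI) auto
  also have "\<dots> = (if i = j then m else 2 * m)"
    using len[OF p(1)] p(2) card_B_Un[OF ij] by (auto split: if_splits)
  finally show ?thesis .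
qed

section \<open>Required color gaps and lower bounds\<close>

text \<open>The detour distances \<open>m\<close> and \<open>2 * m\<close> are subtracted from
  \<open>k * m\<close>. Pairs containing \<open>v\<close> fall under the first conjunct, as
  \<open>v\<close> lies in every copy, and are therefore excluded from the second.\<close>

lemma hamiltonian_coloring_iff:
  "hamiltonian_coloring G c \<longleftrightarrow>
    (\<forall>i<k. \<forall>x\<in>B i. \<forall>y\<in>B i. x \<noteq> y \<longrightarrow> int ((k - 1) * m) \<le> \<bar>int (c x) - int (c y)\<bar>) \<and>
    (\<forall>i<k. \<forall>j<k. \<forall>x\<in>B i - {v}. \<forall>y\<in>B j - {v}.
      i \<noteq> j \<longrightarrow> int ((k - 2) * m) \<le> \<bar>int (c x) - int (c y)\<bar>)"
  (is "?H \<longleftrightarrow> ?same \<and> ?diff")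
proof -
  obtain l where l: "k = l + 2" using k_ge_2 by (metis add.commute le_Suc_ex)
  have bound: "int (card (verts G)) - 1 = int ((k - 1) * m) + int m"
    "int (card (verts G)) - 1 = int ((k - 2) * m) + int (2 * m)"
    by (simp_all add: card_verts l algebra_simps)
  have in_verts: "x \<in> verts G" if "i < k" "x \<in> B i" for i x
    using that verts_eq by auto
  show ?thesis
  proof (intro iffI conjI allI ballI impI)
    fix i x y assume H: ?H and ix: "i < k" "x \<in> B i" "y \<in> B i" "x \<noteq> y"
    have "int (card (verts G)) - 1 \<le> int (detour_distance G x y) + \<bar>int (c x) - int (c y)\<bar>"
      using H in_verts[OF ix(1)] ix unfolding hamiltonian_coloring_def by blast
    then show "int ((k - 1) * m) \<le> \<bar>int (c x) - int (c y)\<bar>"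
      unfolding bound(1) using detour_distance_eq[of i i x y] ix by simp
  next
    fix i j x y
    assume H: ?H and ix: "i < k" "j < k" "x \<in> B i - {v}" "y \<in> B j - {v}" "i \<noteq> j"
    then have "x \<noteq> y" using B_eqI by blast
    then have "int (card (verts G)) - 1 \<le> int (detour_distance G x y) + \<bar>int (c x) - int (c y)\<bar>"
      using H in_verts ix unfolding hamiltonian_coloring_def by blast
    then show "int ((k - 2) * m) \<le> \<bar>int (c x) - int (c y)\<bar>"
      unfolding bound(2) using detour_distance_eq[of i j x y] ix \<open>x \<noteq> y\<close> by simp
  next
    assume sd: "?same \<and> ?diff"
    show ?H
      unfolding hamiltonian_coloring_def
    proof (intro ballI impI)
      fix x y assume xy: "x \<in> verts G" "y \<in> verts G" "x \<noteq> y"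
      show "int (card (verts G)) - 1 \<le> int (detour_distance G x y) + \<bar>int (c x) - int (c y)\<bar>"
      proof (cases "\<exists>i<k. x \<in> B i \<and> y \<in> B i")
        case True
        then obtain i where i: "i < k" "x \<in> B i" "y \<in> B i" by blast
        then have "int ((k - 1) * m) \<le> \<bar>int (c x) - int (c y)\<bar>" using sd xy(3) by blast
        then show ?thesis
          unfolding bound(1) using detour_distance_eq[of i i x y] i xy(3) by simp
      next
        case False
        obtain i j where ij: "i < k" "x \<in> B i" "j < k" "y \<in> B j"
          using xy by (auto simp: verts_eq)
        have ne: "i \<noteq> j" "x \<noteq> v" "y \<noteq> v" using False ij v_in_B by blast+
        then have "int ((k - 2) * m) \<le> \<bar>int (c x) - int (c y)\<bar>" using sd ij by blast
        then show ?thesis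
          unfolding bound(2) using detour_distance_eq[of i j x y] ij ne xy(3) by simp
      qed
    qed
  qed
qed

text \<open>A single copy has \<open>m\<close> gaps of size \<open>(k - 1) * m\<close>. This serves
  \<open>k = 2\<close>, where counting gaps over all vertices yields only \<open>m\<close>.\<close>

lemma hamiltonian_coloring_copy_ge:
  assumes "hamiltonian_coloring G c"
  shows "\<exists>x\<in>verts G. (k - 1) * m\<^sup>2 \<le> c x"
proof -
  have 0: "0 < k" using k_ge_2 by simp
  obtain x where "x \<in> B 0" "0 + (card (B 0) - 1) * ((k - 1) * m) \<le> c x"
  proof (rule separated_ge[of "B 0" 0 c "(k - 1) * m"])
    show "int ((k - 1) * m) \<le> \<bar>int (c x) - int (c y)\<bar>" if "x \<in> B 0" "y \<in> B 0" "x \<noteq> y" for x y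
      using assms that 0 unfolding hamiltonian_coloring_iff by blast
  qed (use finite_B[OF 0] v_in_B[OF 0] in auto)
  then show ?thesis
    using 0 by (auto simp: card_B verts_eq power2_eq_square algebra_simps)
qed

text \<open>
  The vertices colored below \<open>v\<close> and those colored above \<open>v\<close> are counted separately: the larger
  gap next to \<open>v\<close> occurs on at least one of the two sides.
\<close>

lemma hamiltonian_coloring_ge:
  assumes c: "hamiltonian_coloring G c"
  shows "\<exists>x\<in>verts G. k * (k - 2) * m\<^sup>2 + m \<le> c x"
proof -
  define d where "d = (k - 2) * m"
  have dm: "(k - 1) * m = d + m"
    using k_ge_2 unfolding d_def by (cases k) (auto simp: algebra_simps Suc_diff_le)
  have v: "c x + (d + m) \<le> c v \<or> c v + (d + m) \<le> c x" if "x \<in> verts G - {v}" for x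
  proof -
    from that obtain i where "i < k" "x \<in> B i" "x \<noteq> v" by (auto simp: verts_eq)
    then have "int ((k - 1) * m) \<le> \<bar>int (c x) - int (c v)\<bar>"
      using c v_in_B unfolding hamiltonian_coloring_iff by blast
    then show ?thesis unfolding dm by auto
  qed
  have sep: "int d \<le> \<bar>int (c x) - int (c y)\<bar>"
    if xy: "x \<in> verts G - {v}" "y \<in> verts G - {v}" "x \<noteq> y" for x y
  proof -
    from xy obtain i j where ij: "i < k" "x \<in> B i - {v}" "j < k" "y \<in> B j - {v}"
      by (auto simp: verts_eq)
    show ?thesis
    proof (cases "i = j")
      case True
      then have "int ((k - 1) * m) \<le> \<bar>int (c x) - int (c y)\<bar>"
        using c ij xy(3) unfolding hamiltonian_coloring_iff by blast
      then show ?thesis unfolding dm by simp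
    next
      case False
      then show ?thesis using c ij unfolding hamiltonian_coloring_iff d_def by blast
    qed
  qed
  define L where "L = {x \<in> verts G - {v}. c x < c v}"
  define U where "U = {x \<in> verts G - {v}. c v < c x}"
  have fin: "finite L" "finite U" by (auto simp: L_def U_def)
  \<comment> \<open>As \<open>m\<close> is positive, no other vertex shares the color of
    \<open>v\<close>.\<close>
  have "L \<union> U = verts G - {v}" "L \<inter> U = {}"
    using v m_pos by (fastforce simp: L_def U_def)+
  then have card_LU: "card L + card U = k * m"
    using card_Un_disjoint[OF fin] card_verts_minus by simp
  have total: "k * (k - 2) * m\<^sup>2 = (card L + card U) * d"
    unfolding card_LU by (simp add: d_def power2_eq_square)
  have suc: "(card S - 1) * d + d = card S * d" if "finite S" "S \<noteq> {}" for S :: "'a set"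
    using that by (cases "card S") auto
  have below: "L = {} \<or> card L * d + m \<le> c v"
  proof (cases "L = {}")
    case False
    obtain x where x: "x \<in> L" "0 + (card L - 1) * d \<le> c x"
      by (rule separated_ge[OF fin(1) False, of 0 c d]) (use sep in \<open>auto simp: L_def\<close>)
    then have "c x + (d + m) \<le> c v" using v[of x] by (auto simp: L_def)
    then show ?thesis using x suc[OF fin(1) False] by simp
  qed simp
  show ?thesis
  proof (cases "U = {}")
    case True
    then have "L \<noteq> {}" using card_LU m_pos k_ge_2 by auto
    then show ?thesis
      using below True v_in_verts unfolding total by (intro bexI[of _ v]) auto
  next
    case False
    obtain x where x: "x \<in> U" "c v + (d + m) + (card U - 1) * d \<le> c x"
      by (rule separated_ge[OF fin(2) False, of "c v + (d + m)" c d])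
        (use sep v in \<open>fastforce simp: U_def\<close>)+
    \<comment> \<open>The extra \<open>m\<close> below \<open>v\<close> is dropped: it is absent
      when \<open>L\<close> is empty, and the gap above \<open>v\<close> already supplies
      one.\<close>
    moreover have "card L * d \<le> c v" using below by auto
    ultimately have "(card L + card U) * d + m \<le> c x"
      using suc[OF fin(2) False] by (simp add: add_mult_distrib)
    then show ?thesis using x(1) unfolding total by (auto simp: U_def)
  qed
qed

section \<open>Optimal colorings\<close>

text \<open>One function numbers all copies at once; the colorings below use \<open>r x\<close> to
  order the vertices within each copy.\<close>

lemma ex_enumeration: "\<exists>r. \<forall>i<k. bij_betw r (B i - {v}) {0..<m}"
proof -
  have "\<exists>g. bij_betw g (B i - {v}) {0..<m}" if "i < k" for i
    using ex_bij_betw_finite_nat[of "B i - {v}"] finite_B card_B_minus that by auto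
  then obtain g where g: "\<And>i. i < k \<Longrightarrow> bij_betw (g i) (B i - {v}) {0..<m}" by metis
  \<comment> \<open>Away from \<open>v\<close> the copy containing \<open>x\<close> is unique. The
    value at \<open>v\<close> is arbitrary, so \<open>v\<close> is colored separately.\<close>
  define r where "r x = g (THE i. i < k \<and> x \<in> B i) x" for x
  have "r x = g i x" if "i < k" "x \<in> B i - {v}" for i x
  proof -
    have "(THE i. i < k \<and> x \<in> B i) = i" using that B_eqI by (intro the_equality) auto
    then show ?thesis by (simp add: r_def)
  qed
  then have "bij_betw r (B i - {v}) {0..<m}" if "i < k" for i
    using g[OF that] that bij_betw_cong[of "B i - {v}" r "g i"] by simp
  then show ?thesis by blast
qed

text \<open>Vertices of different copies other than \<open>v\<close> are unconstrained, since
  \<open>(k - 2) * m = 0\<close>; both copies can therefore use the colors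
  \<open>0, m, ..., m * m\<close>, with \<open>0\<close> at \<open>v\<close>.\<close>

lemma hc_two:
  assumes "k = 2"
  shows "hc G = m\<^sup>2"
proof -
  obtain r where r: "\<And>i. i < k \<Longrightarrow> bij_betw r (B i - {v}) {0..<m}"
    using ex_enumeration by blast
  define c where "c x = (if x = v then 0 else m * Suc (r x))" for x
  have range: "r x < m" if "i < k" "x \<in> B i - {v}" for i x
    using bij_betwE[OF r[OF that(1)]] that(2) by auto
  show ?thesis
  proof (rule hc_eqI)
    show "\<exists>x\<in>verts G. m\<^sup>2 \<le> c x" if "hamiltonian_coloring G c" for c
      using hamiltonian_coloring_copy_ge[OF that] assms by simp
    show "c x \<le> m\<^sup>2" if x: "x \<in> verts G" for x
    proof -
      obtain i where "i < k" "x \<in> B i" using x by (auto simp: verts_eq)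
      then have "x = v \<or> Suc (r x) \<le> m" using range[of i x] by (cases "x = v") auto
      then show ?thesis
        using mult_le_mono2[of "Suc (r x)" m m] by (auto simp: c_def power2_eq_square)
    qed
    have sep: "int m \<le> \<bar>int (m * a) - int (m * b)\<bar>" if "a \<noteq> b" for a b :: nat
    proof -
      have "int m * 1 \<le> int m * \<bar>int a - int b\<bar>" using that by (intro mult_left_mono) auto
      then show ?thesis by (simp add: abs_mult flip: right_diff_distrib)
    qed
    have "c x = m * (if x = v then 0 else Suc (r x))" for x by (simp add: c_def)
    moreover have "(if x = v then 0 else Suc (r x)) \<noteq> (if y = v then 0 else Suc (r y))"
      if "i < k" "x \<in> B i" "y \<in> B i" "x \<noteq> y" for i x y
      using r[OF that(1)] that by (auto simp: bij_betw_def inj_on_def)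
    ultimately show "hamiltonian_coloring G c"
      unfolding hamiltonian_coloring_iff using sep assms by simp
  qed (use v_in_verts in auto)
qed

lemma hc_ge_three:
  assumes "3 \<le> k"
  shows "hc G = k * (k - 2) * m\<^sup>2 + m"
proof -
  obtain r where r: "\<And>i. i < k \<Longrightarrow> bij_betw r (B i - {v}) {0..<m}"
    using ex_enumeration by blast
  define d where "d = (k - 2) * m"
  have dm: "(k - 1) * m = d + m"
    using k_ge_2 unfolding d_def by (cases k) (auto simp: algebra_simps Suc_diff_le)
  have "1 \<le> k - 2" using assms by linarith
  then have md: "m \<le> d" using mult_le_mono1[of 1 "k - 2" m] by (simp add: d_def)
  define copy where "copy x = (THE i. i < k \<and> x \<in> B i)" for x
  have copy: "copy x = i" if "i < k" "x \<in> B i - {v}" for i x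
    unfolding copy_def using that B_eqI by (intro the_equality) auto
  \<comment> \<open>Round \<open>r x\<close> takes one vertex from each copy in turn; the positions
    run from \<open>0\<close> to \<open>k * m - 1\<close>.\<close>
  define pos where "pos x = r x * k + copy x" for x
  \<comment> \<open>The first color after \<open>v\<close> is \<open>d + m\<close>, the gap required
    next to \<open>v\<close>; later gaps are \<open>d\<close>, and the last color is
    \<open>d * (k * m) + m\<close>.\<close>
  define c where "c x = (if x = v then 0 else d * Suc (pos x) + m)" for x
  have range: "r x < m" if "i < k" "x \<in> B i - {v}" for i x
    using bij_betwE[OF r[OF that(1)]] that(2) by auto
  have sep: "int (l * d) \<le> \<bar>int (c x) - int (c y)\<bar>"
    if "x \<noteq> v" "y \<noteq> v" "int l \<le> \<bar>int (pos x) - int (pos y)\<bar>" for l x y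
  proof -
    have "int d * int l \<le> int d * \<bar>int (pos x) - int (pos y)\<bar>"
      using that by (intro mult_left_mono) auto
    also have "\<dots> = \<bar>int d * (int (pos x) - int (pos y))\<bar>" by (simp add: abs_mult)
    also have "int d * (int (pos x) - int (pos y)) = int (c x) - int (c y)"
      using that by (simp add: c_def algebra_simps)
    finally show ?thesis by (simp add: mult.commute)
  qed
  show ?thesis
  proof (rule hc_eqI)
    show "\<exists>x\<in>verts G. k * (k - 2) * m\<^sup>2 + m \<le> c x" if "hamiltonian_coloring G c" for c
      by (rule hamiltonian_coloring_ge[OF that])
    show "c x \<le> k * (k - 2) * m\<^sup>2 + m" if x: "x \<in> verts G" for x
    proof (cases "x = v")
      case False
      obtain i where i: "i < k" "x \<in> B i" using x by (auto simp: verts_eq)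
      have "pos x < Suc (r x) * k" using copy[of i x] i False by (simp add: pos_def)
      also have "\<dots> \<le> m * k" using range[of i x] i False by (intro mult_le_mono1) simp
      finally have "d * Suc (pos x) \<le> d * (m * k)" by (intro mult_le_mono2) simp
      then show ?thesis using False by (simp add: c_def d_def power2_eq_square algebra_simps)
    qed (simp add: c_def)
    show "hamiltonian_coloring G c"
      unfolding hamiltonian_coloring_iff
    proof (intro conjI allI ballI impI)
      fix i x y assume ix: "i < k" "x \<in> B i" "y \<in> B i" "x \<noteq> y"
      show "int ((k - 1) * m) \<le> \<bar>int (c x) - int (c y)\<bar>"
      proof (cases "x = v \<or> y = v")
        case True
        moreover have "c v = 0" "d + m \<le> c z" if "z \<noteq> v" for z
          using that by (simp_all add: c_def)
        ultimately show ?thesis using ix(4) unfolding dm by fastforce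
      next
        case False
        then have "r x \<noteq> r y"
          using r[OF ix(1)] ix by (auto simp: bij_betw_def inj_on_def)
        then have "int k * 1 \<le> int k * \<bar>int (r x) - int (r y)\<bar>"
          by (intro mult_left_mono) auto
        also have "\<dots> = \<bar>int k * (int (r x) - int (r y))\<bar>" by (simp add: abs_mult)
        also have "int k * (int (r x) - int (r y)) = int (pos x) - int (pos y)"
          using copy[OF ix(1)] ix False by (simp add: pos_def algebra_simps)
        \<comment> \<open>At least \<open>k\<close> gaps separate the two vertices; two suffice,
          since \<open>md\<close> gives \<open>d + m \<le> 2 * d\<close>.\<close>
        finally have "int 2 \<le> \<bar>int (pos x) - int (pos y)\<bar>" using assms by simp
        from sep[OF _ _ this] False show ?thesis using md unfolding dm by simp
      qed
    next
      fix i j x y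
      assume ix: "i < k" "j < k" "x \<in> B i - {v}" "y \<in> B j - {v}" "i \<noteq> j"
      \<comment> \<open>The residue modulo \<open>k\<close> recovers the copy, so different copies
        occupy different positions.\<close>
      have "pos x mod k = i" "pos y mod k = j"
        using copy[OF ix(1,3)] copy[OF ix(2,4)] ix by (simp_all add: pos_def)
      then have "pos x \<noteq> pos y" using ix(5) by metis
      then have "int 1 \<le> \<bar>int (pos x) - int (pos y)\<bar>" by simp
      from sep[OF _ _ this] show "int ((k - 2) * m) \<le> \<bar>int (c x) - int (c y)\<bar>"
        using ix by (simp add: d_def)
    qed
  qed (use v_in_verts in auto)
qed

end

section \<open>From the definition to the locale\<close>

lemma one_point_union_completeE:
  assumes "one_point_union_complete n k G" "2 \<le> n" "2 \<le> k"
  obtains v B where "one_point_union G v B (n - 1) k"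
proof -
  obtain v H where
    H: "\<And>i. i < k \<Longrightarrow> subgraph (H i) G" "\<And>i. i < k \<Longrightarrow> complete_digraph n (H i)"
      "\<And>i. i < k \<Longrightarrow> v \<in> verts (H i)"
    and inter: "\<And>i j. i < k \<Longrightarrow> j < k \<Longrightarrow> i \<noteq> j \<Longrightarrow> verts (H i) \<inter> verts (H j) = {v}"
    and V: "verts G = (\<Union>i<k. verts (H i))" and A: "arcs G = (\<Union>i<k. arcs (H i))"
    using assms(1) unfolding one_point_union_complete_def by metis
  have "graph G" using one_point_union_complete_imp_graph[OF assms(1)] assms(3) by simp
  then interpret graph G .
  \<comment> \<open>Compatibility of subgraphs gives every \<open>H i\<close> the tail and head maps
    of \<open>G\<close>.\<close>
  have ends: "arcs_ends G = (\<Union>i<k. arcs_ends (H i))"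
    using H(1) by (auto simp: arcs_ends_def arc_to_ends_def A subgraph_def compatible_def)
  have "one_point_union G v (\<lambda>i. verts (H i)) (n - 1) k"
  proof unfold_locales
    show "finite (verts (H i))" if "i < k" for i
      using H(1)[OF that] finite_verts by (metis finite_subset subgraph_def)
    show "card (verts (H i)) = Suc (n - 1)" if "i < k" for i
      using H(2)[OF that] assms(2) by (simp add: complete_digraph_def)
    show "(x \<rightarrow>\<^bsub>G\<^esub> y) \<longleftrightarrow> (\<exists>i<k. x \<in> verts (H i) \<and> y \<in> verts (H i) \<and> x \<noteq> y)" for x y
      unfolding ends using H(2) by (auto simp: complete_digraph_def)
  qed (use H(3) inter V assms in auto)
  then show ?thesis by (rule that)
qed

theorem theorem6:
  fixes G :: "('a, 'b) pre_digraph" and n k :: nat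
  assumes "n \<ge> 2" and "k \<ge> 2"
    and "one_point_union_complete n k G"
  shows "hc G = (if k = 2 then (n - 1)^2 else k * (k - 2) * (n - 1)^2 + (n - 1))"
proof -
  obtain v B where "one_point_union G v B (n - 1) k"
    using one_point_union_completeE assms by blast
  then interpret one_point_union G v B "n - 1" k .
  show ?thesis using hc_two hc_ge_three assms(2) by auto
qed

end
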